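(* Let $D\subseteq\mathbb{R}^d$ be open, $f:D\to\mathbb{R}^d$ locally Lipschitz, $x^*\in D$ an equilibrium of $\dot x=f(x)$, and $R>0$ a constant. Let $S:=B_R(x^* )\subseteq D$ and let $L:=L_{\mathrm{cl}\,\mathcal{R}^\tau(S)}$ be the one-sided Lipschitz constant of $f$ over (the closure of) the $\tau$-reachable tube $\mathcal{R}^\tau(S)$, with $\tau$ as given at the end of the statement. Suppose $x^*$ is $\lambda$-exponentially stable over $S$ with constant $C\ge1$, and choose $\alpha\in(0,\lambda)$ such that $$\beta:=\frac{\lambda-\alpha}{\lambda+L}\in(0,1).$$ Define $C_\beta:=C^{\frac{1-\beta}{\beta}}$. Then, the $\varepsilon$-ERLF recurrence condition for $V(x)=\|x-x^*\|$ over $K_\varepsilon:=\mathrm{cl}(S\setminus B_\varepsilon(x^* ))$ can be verified with at most $$N(\varepsilon):=\ln\!\left(\frac R\varepsilon\right)3^{d+1}\,\frac{d\,e}{\beta}\,(2+C_\beta)^{\frac d\beta}=O\!\left(\log\!\left(\frac{R}{\varepsilon}\right)\right)$$ trajectory evaluations of duration $$\tau=\frac{1}{\lambda-\alpha}\ln\!\bigl(C(2+C_\beta)e^{\beta/d}\bigr).$$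
   Context: $\|\cdot\|$ is a fixed norm on $\mathbb{R}^d$ and $B_r(x)$ is the closed ball of radius $r$ around $x$. Locally Lipschitz means: for every compact $K\subset D$ there is $\overline L_K\ge 0$ with $\|f(y)-f(x)\|\le \overline L_K\|y-x\|$ for all $x,y\in K$. For $x\in D$, $\phi(t,x)$ is the solution of $\dot x=f(x)$ with $\phi(0,x)=x$, on its maximal open interval of existence $I(x)\ni 0$. $\lambda$-exponentially stable over $S$ with constant $C\ge1$ ($\lambda>0$): $\|\phi(t,x)-x^*\|\le Ce^{-\lambda t}\|x-x^*\|$ for all $x\in S$, $t\ge0$ (including existence of the solution for all $t\ge 0$). Weak pairing: the norm is equipped with an associated weak pairing $[\cdot;\cdot]:\mathbb{R}^d\times\mathbb{R}^d\to\mathbb{R}$, i.e. a map with (i) $[x_1+x_2;y]\le[x_1;y]+[x_2;y]$; (ii) $[a x;y]=[x;a y]=a[x;y]$ for $a>0$ and $[-x;-y]=[x;y]$; (iii) $[x;x]>0$ for $x\ne0$; (iv) $|[x;y]|\le[x;x]^{1/2}[y;y]^{1/2}$; such that $\|x\|=[x;x]^{1/2}$, and satisfying the curve norm derivative formula $\|x(t)\|\,D^+\|x(t)\|=[\dot x(t);x(t)]$ along differentiable curves, where $D^+\varphi(t)=\limsup_{h\to0^+}(\varphi(t+h)-\varphi(t))/h$. The one-sided Lipschitz constant of $f$ over a compact $K\subset D$ is the smallest $L_K\in\mathbb{R}$ with $[f(y)-f(x);y-x]\le L_K\|y-x\|^2$ for all $x,y\in K$. Reachable tube: $\mathcal{R}^\tau(S)=\{\phi(t,x):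 x\in S,\ t\in[0,\tau]\cap I(x)\}$. The $\varepsilon$-ERLF (exponential recurrent Lyapunov function) recurrence condition with parameters $(\alpha,\tau)$ for $V$ over $K_\varepsilon$, where $\varepsilon>0$ and $B_\varepsilon(x^* )\subset\mathrm{int}(S)$, is: for every $x\in K_\varepsilon$, $\min_{s} e^{\alpha s}V(\phi(s,x))\le V(x)$, the minimum being over those $s\in(0,\tau]$ with $\phi(s,x)\in S$. Verification by trajectory evaluations: one trajectory evaluation of duration $\tau$ means checking, for one center $x_k\in S$ and one radius $r_k>0$, along the single trajectory $\phi(\cdot,x_k)$, that there is $t\in(0,\tau]$ with $e^{\alpha t}\bigl(\|\phi(t,x_k)-x^*\|+r_k e^{Lt}\bigr)\le\|x_k-x^*\|-r_k$. Since $S=B_R(x^* )$, this guarantees the recurrence condition at all points of $B_{r_k}(x_k)\cap S$. The condition over $K_\varepsilon$ is verified with $N$ trajectory evaluations when $N$ such balls, each passing the check, cover $K_\varepsilon$. The $O(\cdot)$ is as $\varepsilon\to0$ with all other quantities fixed.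
   Formalization: The bound is stated for ε ≤ R·exp(−β/(3d)) rather than all ε < R, since for ε close to R the number N(ε) drops below 1 while K_ε is nonempty, so the claim fails there. *)

theory Defs
  imports "HOL-Analysis.Analysis" "HOL-Library.Landau_Symbols"
begin

text \<open>
  The norm on \<open>\<real>\<^sup>d\<close> is an arbitrary function \<open>nrm\<close> on \<^typ>\<open>real^'n\<close> satisfying the norm axioms.
  As all norms on \<open>\<real>\<^sup>d\<close> are equivalent, topological notions and derivatives
  are the library's (Euclidean) ones; balls, Lipschitz constants and estimates refer to \<open>nrm\<close>.
\<close>

definition is_norm :: "(real^'n \<Rightarrow> real) \<Rightarrow> bool" where
  "is_norm nrm \<longleftrightarrow>
     (\<forall>x. 0 \<le> nrm x) \<and> (\<forall>x. nrm x = 0 \<longleftrightarrow> x = 0) \<and>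
     (\<forall>a x. nrm (a *\<^sub>R x) = \<bar>a\<bar> * nrm x) \<and>
     (\<forall>x y. nrm (x + y) \<le> nrm x + nrm y)"

definition nball :: "(real^'n \<Rightarrow> real) \<Rightarrow> real^'n \<Rightarrow> real \<Rightarrow> (real^'n) set" where
  "nball nrm x r = {y. nrm (y - x) \<le> r}"

definition locally_lipschitz ::
    "(real^'n \<Rightarrow> real) \<Rightarrow> (real^'n) set \<Rightarrow> (real^'n \<Rightarrow> real^'n) \<Rightarrow> bool" where
  "locally_lipschitz nrm D f \<longleftrightarrow>
     (\<forall>K. compact K \<and> K \<subseteq> D \<longrightarrow>
        (\<exists>M\<ge>0. \<forall>x\<in>K. \<forall>y\<in>K. nrm (f y - f x) \<le> M * nrm (y - x)))"

definition ivp_solution ::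
    "(real^'n) set \<Rightarrow> (real^'n \<Rightarrow> real^'n) \<Rightarrow> real^'n \<Rightarrow> real set \<Rightarrow> (real \<Rightarrow> real^'n) \<Rightarrow> bool" where
  "ivp_solution D f x I u \<longleftrightarrow>
     open I \<and> is_interval I \<and> 0 \<in> I \<and> u 0 = x \<and>
     (\<forall>t\<in>I. u t \<in> D \<and> (u has_vector_derivative f (u t)) (at t))"

definition existence_interval ::
    "(real^'n) set \<Rightarrow> (real^'n \<Rightarrow> real^'n) \<Rightarrow> real^'n \<Rightarrow> real set" where
  "existence_interval D f x = \<Union>{I. \<exists>u. ivp_solution D f x I u}"

text \<open>
  For locally Lipschitz \<open>f\<close> any two solutions agree where both are defined, so the value
  selected below is unique for \<open>t\<close> in the maximal interval of existence and arbitrary for other \<open>t\<close>.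
\<close>

definition flow ::
    "(real^'n) set \<Rightarrow> (real^'n \<Rightarrow> real^'n) \<Rightarrow> real \<Rightarrow> real^'n \<Rightarrow> real^'n" where
  "flow D f t x = (THE z. \<exists>I u. ivp_solution D f x I u \<and> t \<in> I \<and> u t = z)"

definition exponentially_stable ::
    "(real^'n \<Rightarrow> real) \<Rightarrow> (real^'n) set \<Rightarrow> (real^'n \<Rightarrow> real^'n) \<Rightarrow> real^'n \<Rightarrow>
     real \<Rightarrow> real \<Rightarrow> (real^'n) set \<Rightarrow> bool" where
  "exponentially_stable nrm D f xe lam C S \<longleftrightarrow>
     (\<forall>x\<in>S. \<forall>t\<ge>0. t \<in> existence_interval D f x \<and>
        nrm (flow D f t x - xe) \<le> C * exp (- lam * t) * nrm (x - xe))"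

definition reachable_tube ::
    "(real^'n) set \<Rightarrow> (real^'n \<Rightarrow> real^'n) \<Rightarrow> real \<Rightarrow> (real^'n) set \<Rightarrow> (real^'n) set" where
  "reachable_tube D f \<tau> S =
     {flow D f t x | t x. x \<in> S \<and> t \<in> {0..\<tau>} \<inter> existence_interval D f x}"

definition upper_right_dini :: "(real \<Rightarrow> real) \<Rightarrow> real \<Rightarrow> ereal" where
  "upper_right_dini g t = Limsup (at_right 0) (\<lambda>h. ereal ((g (t + h) - g t) / h))"

definition weak_pairing :: "(real^'n \<Rightarrow> real^'n \<Rightarrow> real) \<Rightarrow> bool" where
  "weak_pairing wp \<longleftrightarrow>
     (\<forall>x1 x2 y. wp (x1 + x2) y \<le> wp x1 y + wp x2 y) \<and>
     (\<forall>a x y. a > 0 \<longrightarrow> wp (a *\<^sub>R x) y = a * wp x y \<and> wp x (a *\<^sub>R y) = a * wp x y) \<and>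
     (\<forall>x y. wp (- x) (- y) = wp x y) \<and>
     (\<forall>x. x \<noteq> 0 \<longrightarrow> wp x x > 0) \<and>
     (\<forall>x y. \<bar>wp x y\<bar> \<le> sqrt (wp x x) * sqrt (wp y y))"

definition curve_norm_derivative_formula ::
    "(real^'n \<Rightarrow> real) \<Rightarrow> (real^'n \<Rightarrow> real^'n \<Rightarrow> real) \<Rightarrow> bool" where
  "curve_norm_derivative_formula nrm wp \<longleftrightarrow>
     (\<forall>a b x x'. (\<forall>t\<in>{a<..<b}. (x has_vector_derivative x' t) (at t)) \<longrightarrow>
        (\<forall>t\<in>{a<..<b}.
           ereal (nrm (x t)) * upper_right_dini (\<lambda>s. nrm (x s)) t = ereal (wp (x' t) (x t))))"

definition associated_weak_pairing ::
    "(real^'n \<Rightarrow> real) \<Rightarrow> (real^'n \<Rightarrow> real^'n \<Rightarrow> real) \<Rightarrow> bool" where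
  "associated_weak_pairing nrm wp \<longleftrightarrow>
     weak_pairing wp \<and> (\<forall>x. nrm x = sqrt (wp x x)) \<and> curve_norm_derivative_formula nrm wp"

definition one_sided_lipschitz_on ::
    "(real^'n \<Rightarrow> real) \<Rightarrow> (real^'n \<Rightarrow> real^'n \<Rightarrow> real) \<Rightarrow> (real^'n \<Rightarrow> real^'n) \<Rightarrow>
     (real^'n) set \<Rightarrow> real \<Rightarrow> bool" where
  "one_sided_lipschitz_on nrm wp f K L \<longleftrightarrow>
     (\<forall>x\<in>K. \<forall>y\<in>K. wp (f y - f x) (y - x) \<le> L * (nrm (y - x))\<^sup>2)"

definition is_one_sided_lipschitz_constant ::
    "(real^'n \<Rightarrow> real) \<Rightarrow> (real^'n \<Rightarrow> real^'n \<Rightarrow> real) \<Rightarrow> (real^'n \<Rightarrow> real^'n) \<Rightarrow>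
     (real^'n) set \<Rightarrow> real \<Rightarrow> bool" where
  "is_one_sided_lipschitz_constant nrm wp f K L \<longleftrightarrow>
     one_sided_lipschitz_on nrm wp f K L \<and>
     (\<forall>M. one_sided_lipschitz_on nrm wp f K M \<longrightarrow> L \<le> M)"

text \<open>
  The minimum over \<open>s\<close> is required to be attained; \<^const>\<open>is_arg_min\<close> expresses this.
\<close>

definition erlf_recurrence ::
    "(real^'n) set \<Rightarrow> (real^'n \<Rightarrow> real^'n) \<Rightarrow> (real^'n \<Rightarrow> real) \<Rightarrow> (real^'n) set \<Rightarrow>
     real \<Rightarrow> real \<Rightarrow> (real^'n) set \<Rightarrow> bool" where
  "erlf_recurrence D f V S \<alpha> \<tau> K \<longleftrightarrow>
     (\<forall>x\<in>K. \<exists>s.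
        is_arg_min (\<lambda>s. exp (\<alpha> * s) * V (flow D f s x))
          (\<lambda>s. s \<in> {0<..\<tau>} \<inter> existence_interval D f x \<and> flow D f s x \<in> S) s \<and>
        exp (\<alpha> * s) * V (flow D f s x) \<le> V x)"

definition trajectory_check ::
    "(real^'n \<Rightarrow> real) \<Rightarrow> (real^'n) set \<Rightarrow> (real^'n \<Rightarrow> real^'n) \<Rightarrow> real^'n \<Rightarrow>
     real \<Rightarrow> real \<Rightarrow> real \<Rightarrow> real^'n \<Rightarrow> real \<Rightarrow> bool" where
  "trajectory_check nrm D f xe \<alpha> L \<tau> c r \<longleftrightarrow>
     (\<exists>t \<in> {0<..\<tau>} \<inter> existence_interval D f c.
        exp (\<alpha> * t) * (nrm (flow D f t c - xe) + r * exp (L * t)) \<le> nrm (c - xe) - r)"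

definition verified_with_evaluations ::
    "(real^'n \<Rightarrow> real) \<Rightarrow> (real^'n) set \<Rightarrow> (real^'n \<Rightarrow> real^'n) \<Rightarrow> real^'n \<Rightarrow>
     (real^'n) set \<Rightarrow> real \<Rightarrow> real \<Rightarrow> real \<Rightarrow> (real^'n) set \<Rightarrow> nat \<Rightarrow> bool" where
  "verified_with_evaluations nrm D f xe S \<alpha> L \<tau> K n \<longleftrightarrow>
     (\<exists>c r. (\<forall>k<n. c k \<in> S \<and> r k > 0 \<and> trajectory_check nrm D f xe \<alpha> L \<tau> (c k) (r k)) \<and>
            K \<subseteq> (\<Union>k<n. nball nrm (c k) (r k)))"

end

theory Submission
  imports Defs
begin

text \<open>
  Exponential stability gives, at a center \<open>c\<close> with \<open>\<rho> = \<parallel>c - x\<^sup>*\<parallel>\<close> and at the time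
  \<open>t = ln (C A) / (\<lambda> - \<alpha>)\<close> with \<open>A = 2 + C\<^sub>\<beta>\<close>, that the trajectory check succeeds for every radius
  at most \<open>A powr (-1/\<beta>) * \<rho>\<close>.  The annulus \<open>\<epsilon> \<le> \<parallel>x - x\<^sup>*\<parallel> \<le> R\<close> is cut into geometric shells of ratio
  \<open>exp (\<beta>/d)\<close>; comparing volumes, a maximal separated subset of a shell with inner radius \<open>a\<close>
  has at most \<open>(3 exp (\<beta>/d) A powr (1/\<beta>)) ^ d\<close> points if the separation is
  \<open>A powr (-1/\<beta>) * a\<close>.  The recurrence condition itself holds because at time \<open>\<tau>\<close> the weighted
  value of \<open>V\<close> lies strictly below \<open>V x\<close>, so the minimum over the compact set of admissible
  times in \<open>[0, \<tau>]\<close> is not attained at \<open>0\<close>.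
\<close>

section \<open>Norms on Euclidean space\<close>

lemma is_normD:
  assumes "is_norm nrm"
  shows "0 \<le> nrm x" "nrm x = 0 \<longleftrightarrow> x = 0" "nrm (a *\<^sub>R x) = \<bar>a\<bar> * nrm x"
    "nrm (x + y) \<le> nrm x + nrm y" "nrm 0 = 0" "nrm (- x) = nrm x"
    "nrm (x - y) = nrm (y - x)"
proof -
  show "0 \<le> nrm x" "nrm x = 0 \<longleftrightarrow> x = 0" "nrm (a *\<^sub>R x) = \<bar>a\<bar> * nrm x"
    "nrm (x + y) \<le> nrm x + nrm y" "nrm 0 = 0"
    using assms by (auto simp: is_norm_def)
  have minus: "nrm (- z) = nrm z" for z
    using assms unfolding is_norm_def
    by (metis abs_minus_cancel abs_one mult_1 scaleR_minus1_left)
  show "nrm (- x) = nrm x" "nrm (x - y) = nrm (y - x)"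
    using minus[of x] minus[of "x - y"] by simp_all
qed

text \<open>A norm is a finite convex function on the whole space, hence continuous. This route
  precedes norm equivalence, whose proof needs continuity on the sphere.\<close>

lemma is_norm_continuous_on:
  fixes nrm :: "real^'n \<Rightarrow> real"
  assumes "is_norm nrm"
  shows "continuous_on A nrm"
proof -
  have "convex_on UNIV nrm"
  proof (rule convex_onI)
    fix t :: real and x y :: "real^'n"
    assume "0 < t" "t < 1"
    then show "nrm ((1 - t) *\<^sub>R x + t *\<^sub>R y) \<le> (1 - t) * nrm x + t * nrm y"
      using is_normD(4)[OF assms, of "(1 - t) *\<^sub>R x" "t *\<^sub>R y"]
      by (simp add: is_normD(3)[OF assms])
  qed simp
  then have "continuous_on UNIV nrm"
    by (intro convex_on_continuous) auto
  then show ?thesis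
    by (rule continuous_on_subset) simp
qed

text \<open>The constants are the extreme values of \<open>nrm\<close> on the compact Euclidean unit
  sphere, extended by homogeneity. They carry compactness and Lipschitz bounds between
  \<open>nrm\<close> and the Euclidean norm.\<close>

lemma is_norm_equivalent:
  fixes nrm :: "real^'n \<Rightarrow> real"
  assumes "is_norm nrm"
  obtains m M where "0 < m" "0 < M" "\<And>x. m * norm x \<le> nrm x" "\<And>x. nrm x \<le> M * norm x"
proof -
  let ?U = "sphere (0::real^'n) 1"
  have ne: "?U \<noteq> {}" by simp
  have cont: "continuous_on ?U nrm"
    by (rule is_norm_continuous_on[OF assms])
  obtain p where p: "p \<in> ?U" "\<forall>y\<in>?U. nrm p \<le> nrm y"
    using continuous_attains_inf[OF compact_sphere ne cont] by blast
  obtain q where q: "q \<in> ?U" "\<forall>y\<in>?U. nrm y \<le> nrm q"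
    using continuous_attains_sup[OF compact_sphere ne cont] by blast
  have pos: "0 < nrm z" if "z \<in> ?U" for z
  proof -
    from that have "z \<noteq> 0" by auto
    then show ?thesis using is_normD(1,2)[OF assms, of z] by linarith
  qed
  have scale: "nrm x = norm x * nrm ((1 / norm x) *\<^sub>R x)" "(1 / norm x) *\<^sub>R x \<in> ?U"
    if "x \<noteq> 0" for x
    using that by (auto simp: is_normD(3)[OF assms])
  show ?thesis
  proof
    show "nrm p * norm x \<le> nrm x" for x
    proof (cases "x = 0")
      case False
      have "nrm p \<le> nrm ((1 / norm x) *\<^sub>R x)" using p(2) scale(2)[OF False] by blast
      then have "norm x * nrm p \<le> norm x * nrm ((1 / norm x) *\<^sub>R x)"
        by (rule mult_left_mono) simp
      then show ?thesis using scale(1)[OF False] by (simp only: mult.commute)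
    qed (simp add: is_normD(5)[OF assms])
    show "nrm x \<le> nrm q * norm x" for x
    proof (cases "x = 0")
      case False
      have "nrm ((1 / norm x) *\<^sub>R x) \<le> nrm q" using q(2) scale(2)[OF False] by blast
      then have "norm x * nrm ((1 / norm x) *\<^sub>R x) \<le> norm x * nrm q"
        by (rule mult_left_mono) simp
      then show ?thesis using scale(1)[OF False] by (simp only: mult.commute)
    qed (simp add: is_normD(5)[OF assms])
  qed (use pos p(1) q(1) in auto)
qed

lemma closed_nball:
  fixes nrm :: "real^'n \<Rightarrow> real"
  assumes "is_norm nrm"
  shows "closed (nball nrm x r)"
  unfolding nball_def
  by (intro closed_Collect_le continuous_on_compose2[OF is_norm_continuous_on[OF assms, of UNIV]]
      continuous_intros) auto

lemma compact_nball:
  fixes nrm :: "real^'n \<Rightarrow> real"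
  assumes "is_norm nrm"
  shows "compact (nball nrm x r)"
proof -
  obtain m where m: "0 < m" "\<And>x. m * norm x \<le> nrm x"
    using is_norm_equivalent[OF assms] by metis
  have "nball nrm x r \<subseteq> cball x (r / m)"
  proof
    fix y assume "y \<in> nball nrm x r"
    then have "m * norm (y - x) \<le> r" using m(2)[of "y - x"] by (simp add: nball_def)
    then show "y \<in> cball x (r / m)"
      using m(1) by (simp add: dist_norm norm_minus_commute field_simps)
  qed
  then show ?thesis
    using closed_nball[OF assms] bounded_subset[OF bounded_cball]
    by (auto simp: compact_eq_bounded_closed)
qed

text \<open>Every ball is the image of the unit ball under \<open>y \<mapsto> r y + x\<close>, and
  Lebesgue measure scales accordingly. So ratios of volumes do not depend on the norm.\<close>

lemma measure_nball:
  fixes nrm :: "real^'n \<Rightarrow> real"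
  assumes "is_norm nrm" "0 < r"
  shows "measure lebesgue (nball nrm x r) = r ^ CARD('n) * measure lebesgue (nball nrm 0 1)"
proof -
  have "nball nrm x r = (\<lambda>y. r *\<^sub>R y + x) ` nball nrm 0 1"
  proof (intro equalityI subsetI)
    fix y assume "y \<in> nball nrm x r"
    then have "nrm ((1 / r) *\<^sub>R (y - x)) \<le> 1"
      using \<open>0 < r\<close> by (simp only: is_normD(3)[OF assms(1)]) (simp add: nball_def)
    then show "y \<in> (\<lambda>y. r *\<^sub>R y + x) ` nball nrm 0 1"
      using \<open>0 < r\<close> by (intro image_eqI[of _ _ "(1 / r) *\<^sub>R (y - x)"]) (auto simp: nball_def)
  qed (use \<open>0 < r\<close> in \<open>auto simp: nball_def is_normD(3)[OF assms(1)] mult_left_le\<close>)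
  then show ?thesis
    using \<open>0 < r\<close> by (simp add: measure_lebesgue_affine)
qed

lemma measure_nball_pos:
  fixes nrm :: "real^'n \<Rightarrow> real"
  assumes "is_norm nrm"
  shows "0 < measure lebesgue (nball nrm 0 1)"
proof -
  obtain M where M: "0 < M" "\<And>x. nrm x \<le> M * norm x"
    using is_norm_equivalent[OF assms] by metis
  have "ball 0 (1 / M) \<subseteq> nball nrm 0 1"
  proof
    fix y :: "real^'n" assume "y \<in> ball 0 (1 / M)"
    then have "M * norm y < 1" using M(1) by (simp add: field_simps)
    then show "y \<in> nball nrm 0 1" using M(2)[of y] by (simp add: nball_def)
  qed
  then have "measure lebesgue (ball (0::real^'n) (1 / M)) \<le> measure lebesgue (nball nrm 0 1)"
    by (intro measure_mono_fmeasurable lmeasurable_compact compact_nball assms) auto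
  moreover have "0 < measure lebesgue (ball (0::real^'n) (1 / M))"
    using content_ball_pos[of "1 / M"] M(1) by simp
  ultimately show ?thesis by linarith
qed

section \<open>Covering by volume comparison\<close>

text \<open>Balls of half the separation around the points are disjoint and fit into the ball of
  radius \<open>\<rho> + r / 2\<close>; comparing volumes, the positive volume of the unit ball
  cancels.\<close>

lemma card_separated_le:
  fixes nrm :: "real^'n \<Rightarrow> real"
  assumes "is_norm nrm" "finite P" "P \<subseteq> nball nrm x \<rho>" "0 < r" "0 \<le> \<rho>"
    and sep: "\<And>p q. p \<in> P \<Longrightarrow> q \<in> P \<Longrightarrow> p \<noteq> q \<Longrightarrow> r < nrm (p - q)"
  shows "real (card P) \<le> (1 + 2 * \<rho> / r) ^ CARD('n)"
proof -
  let ?\<mu> = "measure lebesgue :: (real^'n) set \<Rightarrow> real"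
  let ?\<omega> = "?\<mu> (nball nrm 0 1)"
  have pos: "0 < ?\<omega>" by (rule measure_nball_pos[OF assms(1)])
  have "disjnt (nball nrm p (r / 2)) (nball nrm q (r / 2))"
    if "p \<in> P" "q \<in> P" "p \<noteq> q" for p q
  proof -
    have False if "nrm (y - p) \<le> r / 2" "nrm (y - q) \<le> r / 2" for y
      using that sep[OF \<open>p \<in> P\<close> \<open>q \<in> P\<close> \<open>p \<noteq> q\<close>] is_normD(7)[OF assms(1), of y p]
        is_normD(4)[OF assms(1), of "p - y" "y - q"] by simp
    then show ?thesis by (auto simp: disjnt_def nball_def)
  qed
  then have "?\<mu> (\<Union>p\<in>P. nball nrm p (r / 2)) = (\<Sum>p\<in>P. ?\<mu> (nball nrm p (r / 2)))"
    by (intro measure_UNION' assms lmeasurable_compact compact_nball)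
      (auto simp: pairwise_def)
  also have "\<dots> = real (card P) * ((r / 2) ^ CARD('n) * ?\<omega>)"
    using \<open>0 < r\<close> by (simp add: measure_nball[OF assms(1), of "r / 2"])
  finally have "real (card P) * ((r / 2) ^ CARD('n) * ?\<omega>)
      = ?\<mu> (\<Union>p\<in>P. nball nrm p (r / 2))" ..
  also have "\<dots> \<le> ?\<mu> (nball nrm x (\<rho> + r / 2))"
  proof (rule measure_mono_fmeasurable)
    show "(\<Union>p\<in>P. nball nrm p (r / 2)) \<subseteq> nball nrm x (\<rho> + r / 2)"
    proof safe
      fix y p assume "p \<in> P" "y \<in> nball nrm p (r / 2)"
      then have "nrm (y - p) \<le> r / 2" "nrm (p - x) \<le> \<rho>"
        using assms(3) by (auto simp: nball_def)
      then show "y \<in> nball nrm x (\<rho> + r / 2)"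
        using is_normD(4)[OF assms(1), of "y - p" "p - x"] by (simp add: nball_def)
    qed
    show "(\<Union>p\<in>P. nball nrm p (r / 2)) \<in> sets lebesgue"
      using assms(2) lmeasurable_compact[OF compact_nball[OF assms(1)]]
      by (intro sets.finite_UN) auto
  qed (intro lmeasurable_compact compact_nball assms)
  also have "\<dots> = (\<rho> + r / 2) ^ CARD('n) * ?\<omega>"
    using assms(4,5) by (intro measure_nball[OF assms(1)]) simp
  finally have "real (card P) * (r / 2) ^ CARD('n) \<le> (\<rho> + r / 2) ^ CARD('n)"
    using pos by (simp add: mult.assoc[symmetric])
  also have "\<rho> + r / 2 = (1 + 2 * \<rho> / r) * (r / 2)"
    using \<open>0 < r\<close> by (simp add: field_simps)
  finally have "real (card P) * (r / 2) ^ CARD('n) \<le> (1 + 2 * \<rho> / r) ^ CARD('n) * (r / 2) ^ CARD('n)"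
    by (simp only: power_mult_distrib)
  then show ?thesis
    using \<open>0 < r\<close> by (simp only: mult_le_cancel_right_pos zero_less_power half_gt_zero)
qed

text \<open>A separated subset of greatest cardinality covers, since an uncovered point could be
  added to it; the packing bound makes a greatest cardinality exist. The centers stay in
  \<open>Q\<close>, which later controls their distance to the equilibrium.\<close>

lemma nball_cover_exists:
  fixes nrm :: "real^'n \<Rightarrow> real"
  assumes "is_norm nrm" "Q \<subseteq> nball nrm x \<rho>" "0 < r" "0 \<le> \<rho>"
  obtains P where "finite P" "P \<subseteq> Q" "Q \<subseteq> (\<Union>p\<in>P. nball nrm p r)"
    "real (card P) \<le> (1 + 2 * \<rho> / r) ^ CARD('n)"
proof -
  let ?sep = "\<lambda>P. finite P \<and> P \<subseteq> Q \<and> (\<forall>p\<in>P. \<forall>q\<in>P. p \<noteq> q \<longrightarrow> r < nrm (p - q))"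
  have bound: "real (card P) \<le> (1 + 2 * \<rho> / r) ^ CARD('n)" if "?sep P" for P
    using that assms by (intro card_separated_le[OF assms(1)]) auto
  obtain b :: nat where b: "(1 + 2 * \<rho> / r) ^ CARD('n) < real b"
    using reals_Archimedean2 by blast
  have "\<exists>P. ?sep P \<and> (\<forall>P'. ?sep P' \<longrightarrow> card P' \<le> card P)"
  proof (rule Lattices_Big.ex_has_greatest_nat)
    show "?sep {}" by simp
    show "\<forall>P. ?sep P \<longrightarrow> card P < b"
      using bound b by (meson of_nat_less_iff order_le_less_trans)
  qed
  then obtain P where P: "?sep P" and max: "\<And>P'. ?sep P' \<Longrightarrow> card P' \<le> card P"
    by blast
  have "Q \<subseteq> (\<Union>p\<in>P. nball nrm p r)"
  proof (rule ccontr)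
    assume "\<not> ?thesis"
    then obtain y where y: "y \<in> Q" "\<And>p. p \<in> P \<Longrightarrow> r < nrm (y - p)"
      unfolding nball_def by (force simp: not_le)
    have "y \<notin> P" using y(2)[of y] is_normD(5)[OF assms(1)] \<open>0 < r\<close> by auto
    moreover have "?sep (insert y P)"
      using P y is_normD(7)[OF assms(1)] by auto
    ultimately show False
      using max[of "insert y P"] P by simp
  qed
  then show ?thesis using that[of P] P bound[OF P] by blast
qed

section \<open>Uniqueness of solutions and the flow\<close>

lemma ivp_solution_continuous_on:
  assumes "ivp_solution D f x I u"
  shows "continuous_on I u"
  using assms unfolding ivp_solution_def
  by (meson continuous_at_imp_continuous_on has_vector_derivative_continuous)

lemma locally_lipschitz_euclidean:
  fixes nrm :: "real^'n \<Rightarrow> real"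
  assumes "is_norm nrm" "locally_lipschitz nrm D f" "compact K" "K \<subseteq> D"
  obtains B where "0 < B" "\<And>x y. x \<in> K \<Longrightarrow> y \<in> K \<Longrightarrow> norm (f y - f x) \<le> B * norm (y - x)"
proof -
  obtain m M where mM: "0 < m" "0 < M" "\<And>x. m * norm x \<le> nrm x" "\<And>x. nrm x \<le> M * norm x"
    using is_norm_equivalent[OF assms(1)] by metis
  obtain B where B: "0 \<le> B" "\<And>x y. x \<in> K \<Longrightarrow> y \<in> K \<Longrightarrow> nrm (f y - f x) \<le> B * nrm (y - x)"
    using assms(2-4) unfolding locally_lipschitz_def by metis
  show ?thesis
  proof
    \<comment> \<open>The summand 1 makes the constant strictly positive, so that it can be divided
      by when a step length is chosen.\<close>
    show "0 < B * M / m + 1" using B(1) mM by (simp add: add_nonneg_pos)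
    fix x y assume xy: "x \<in> K" "y \<in> K"
    have "m * norm (f y - f x) \<le> B * nrm (y - x)"
      using mM(3)[of "f y - f x"] B(2)[OF xy] by linarith
    also have "\<dots> \<le> B * (M * norm (y - x))"
      by (intro mult_left_mono mM B)
    finally have "norm (f y - f x) \<le> B * M / m * norm (y - x)"
      using mM(1) by (simp add: field_simps)
    also have "\<dots> \<le> (B * M / m + 1) * norm (y - x)"
      by (intro mult_right_mono) auto
    finally show "norm (f y - f x) \<le> (B * M / m + 1) * norm (y - x)" .
  qed
qed

text \<open>On a short enough interval the mean value inequality bounds the maximal distance of the
  two curves by half of itself, so it vanishes.\<close>

lemma solutions_agree_locally:
  fixes nrm :: "real^'n \<Rightarrow> real" and u v :: "real \<Rightarrow> real^'n"
  assumes "is_norm nrm" "open D" "locally_lipschitz nrm D f"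
    and T: "open T" "t0 \<in> T"
    and u: "\<And>t. t \<in> T \<Longrightarrow> (u has_vector_derivative f (u t)) (at t)"
    and v: "\<And>t. t \<in> T \<Longrightarrow> (v has_vector_derivative f (v t)) (at t)"
    and eq: "u t0 = v t0" and "u t0 \<in> D"
  obtains \<delta> where "0 < \<delta>" "cball t0 \<delta> \<subseteq> T" "\<And>t. t \<in> cball t0 \<delta> \<Longrightarrow> u t = v t"
proof -
  obtain e where e: "0 < e" "cball (u t0) e \<subseteq> D"
    using assms(2) \<open>u t0 \<in> D\<close> open_contains_cball by blast
  obtain B where B: "0 < B"
    "\<And>x y. x \<in> cball (u t0) e \<Longrightarrow> y \<in> cball (u t0) e \<Longrightarrow> norm (f y - f x) \<le> B * norm (y - x)"
    using locally_lipschitz_euclidean[OF assms(1,3) compact_cball e(2)] by metis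
  obtain d1 where d1: "0 < d1" "cball t0 d1 \<subseteq> T"
    using T open_contains_cball by blast
  have "isCont u t0" "isCont v t0"
    using u v T(2) has_vector_derivative_continuous by blast+
  then obtain d2 d3 where d2: "0 < d2" "\<And>t. dist t t0 < d2 \<Longrightarrow> dist (u t) (u t0) < e"
    and d3: "0 < d3" "\<And>t. dist t t0 < d3 \<Longrightarrow> dist (v t) (v t0) < e"
    using e(1) unfolding continuous_at_eps_delta by metis
  \<comment> \<open>Halving \<open>d2\<close> and \<open>d3\<close> keeps the closed interval inside
    the open ranges where both curves stay in the Lipschitz ball; \<open>1 / (2 * B)\<close> yields
    the contraction factor 1/2.\<close>
  define \<delta> where "\<delta> = Min {d1, d2 / 2, d3 / 2, 1 / (2 * B)}"
  have \<delta>: "0 < \<delta>" "\<delta> \<le> d1" "\<delta> < d2" "\<delta> < d3" "\<delta> \<le> 1 / (2 * B)"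
    using d1(1) d2(1) d3(1) B(1) by (auto simp: \<delta>_def min_def)
  let ?J = "cball t0 \<delta>"
  have J: "?J \<subseteq> T" using d1(2) \<delta>(2) by auto
  have uin: "u t \<in> cball (u t0) e" if "t \<in> ?J" for t
    using d2(2)[of t] that \<delta>(3) by (auto simp: dist_commute)
  have vin: "v t \<in> cball (u t0) e" if "t \<in> ?J" for t
    using d3(2)[of t] that \<delta>(4) eq by (auto simp: dist_commute)
  let ?w = "\<lambda>t. u t - v t"
  have der: "(?w has_vector_derivative f (u t) - f (v t)) (at t within ?J)" if "t \<in> ?J" for t
    using J that
    by (intro has_vector_derivative_diff has_vector_derivative_at_within[OF u]
        has_vector_derivative_at_within[OF v]) auto
  have "continuous_on ?J ?w"
    using der by (meson continuous_on_eq_continuous_within has_vector_derivative_continuous)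
  then have "continuous_on ?J (\<lambda>t. norm (?w t))"
    by (rule continuous_on_norm)
  moreover have "?J \<noteq> {}" using \<delta>(1) by simp
  ultimately obtain s where s: "s \<in> ?J" "\<And>t. t \<in> ?J \<Longrightarrow> norm (?w t) \<le> norm (?w s)"
    using continuous_attains_sup[OF compact_cball, of t0 \<delta> "\<lambda>t. norm (?w t)"] by blast
  \<comment> \<open>As \<open>s\<close> maximizes the distance, \<open>B * norm (?w s)\<close>
    bounds the speed of \<open>?w\<close> on the whole interval.\<close>
  have "norm (?w s - ?w t0) \<le> B * norm (?w s) * norm (s - t0)"
  proof (rule differentiable_bound[OF convex_cball])
    fix t assume t: "t \<in> ?J"
    show "(?w has_derivative (\<lambda>h. h *\<^sub>R (f (u t) - f (v t)))) (at t within ?J)"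
      using der[OF t] by (simp add: has_vector_derivative_def)
    have "norm (f (u t) - f (v t)) \<le> B * norm (?w t)"
      by (rule B(2)[OF vin[OF t] uin[OF t]])
    also have "\<dots> \<le> B * norm (?w s)"
      using s(2)[OF t] B(1) by (intro mult_left_mono) auto
    finally show "onorm (\<lambda>h. h *\<^sub>R (f (u t) - f (v t))) \<le> B * norm (?w s)"
      by (simp add: onorm_scaleR_left onorm_id)
  qed (use s(1) \<delta>(1) in auto)
  also have "norm (s - t0) \<le> 1 / (2 * B)"
    using s(1) \<delta>(5) by (auto simp: dist_norm norm_minus_commute)
  finally have "norm (?w s) \<le> B * norm (?w s) * (1 / (2 * B))"
    using eq B(1) by (simp add: mult_left_mono)
  then have "norm (?w s) = 0" using B(1) by simp
  then have "u t = v t" if "t \<in> ?J" for t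
    using s(2)[OF that] by simp
  then show ?thesis using that[OF \<delta>(1) J] by blast
qed

text \<open>A connectedness argument: within the common interval the set of agreement contains 0, is
  relatively closed by continuity and open by local agreement.\<close>

lemma ivp_solution_unique:
  fixes nrm :: "real^'n \<Rightarrow> real"
  assumes "is_norm nrm" "open D" "locally_lipschitz nrm D f"
    and u: "ivp_solution D f x I u" and v: "ivp_solution D f x J v"
    and t: "t \<in> I" "t \<in> J"
  shows "u t = v t"
proof -
  let ?T = "I \<inter> J"
  let ?E = "{t \<in> ?T. u t - v t = 0}"
  have T: "open ?T" "0 \<in> ?T" "connected ?T"
    using u v unfolding ivp_solution_def
    by (auto intro: is_interval_connected is_interval_Int)
  have "continuous_on ?T (\<lambda>t. u t - v t)"
    using ivp_solution_continuous_on[OF u] ivp_solution_continuous_on[OF v]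
    by (intro continuous_on_diff) (auto elim: continuous_on_subset)
  then have closed: "closedin (top_of_set ?T) ?E"
    by (rule continuous_closedin_preimage_constant)
  have "open ?E"
    unfolding open_contains_cball
  proof
    fix t0 assume "t0 \<in> ?E"
    then have t0: "t0 \<in> ?T" "u t0 = v t0" by auto
    obtain \<delta> where "0 < \<delta>" "cball t0 \<delta> \<subseteq> ?T" "\<And>t. t \<in> cball t0 \<delta> \<Longrightarrow> u t = v t"
      using u v t0 unfolding ivp_solution_def
      by (elim conjE) (rule solutions_agree_locally[OF assms(1-3) T(1) t0(1), of u v]; auto)
    then show "\<exists>e>0. cball t0 e \<subseteq> ?E" by auto
  qed
  then have "openin (top_of_set ?T) ?E"
    by (intro open_subset) auto
  moreover have "0 \<in> ?E" using T(2) u v by (auto simp: ivp_solution_def)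
  ultimately have "?E = ?T"
    using T(3) closed unfolding connected_clopen by blast
  then show ?thesis using t by auto
qed

text \<open>Uniqueness justifies the definite description in \<open>flow\<close>, so any solution at
  hand may replace it.\<close>

lemma flow_eq_solution:
  fixes nrm :: "real^'n \<Rightarrow> real"
  assumes "is_norm nrm" "open D" "locally_lipschitz nrm D f"
    and u: "ivp_solution D f x I u" and t: "t \<in> I"
  shows "flow D f t x = u t"
  unfolding flow_def
proof (rule the_equality)
  show "\<exists>I v. ivp_solution D f x I v \<and> t \<in> I \<and> v t = u t"
    using u t by blast
qed (use ivp_solution_unique[OF assms(1-3) u] t in metis)

text \<open>A single solution reaching \<open>s\<close> is defined on all of \<open>{0..s}\<close>,
  because its domain is an interval containing 0; there the flow is this one continuous
  curve.\<close>

lemma existence_interval_flow: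
  fixes nrm :: "real^'n \<Rightarrow> real"
  assumes "is_norm nrm" "open D" "locally_lipschitz nrm D f"
    and s: "s \<in> existence_interval D f x" "0 \<le> s"
  shows "{0..s} \<subseteq> existence_interval D f x"
    and "continuous_on {0..s} (\<lambda>t. flow D f t x)"
    and "flow D f 0 x = x"
proof -
  obtain I u where u: "ivp_solution D f x I u" and sI: "s \<in> I"
    using s(1) unfolding existence_interval_def by blast
  have "0 \<in> I" "is_interval I" and u0: "u 0 = x" using u by (auto simp: ivp_solution_def)
  then have sub: "{0..s} \<subseteq> I"
    using sI by (meson atLeastAtMost_iff mem_is_interval_1_I subsetI)
  then show "{0..s} \<subseteq> existence_interval D f x"
    using u unfolding existence_interval_def by blast
  have eq: "flow D f t x = u t" if "t \<in> I" for t
    by (rule flow_eq_solution[OF assms(1-3) u that])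
  show "flow D f 0 x = x" using eq \<open>0 \<in> I\<close> u0 by simp
  have "continuous_on {0..s} u"
    using ivp_solution_continuous_on[OF u] sub continuous_on_subset by blast
  then show "continuous_on {0..s} (\<lambda>t. flow D f t x)"
    using eq sub by (subst continuous_on_cong[OF refl, of _ _ u]) auto
qed

section \<open>Recurrence and trajectory checks under exponential stability\<close>

lemma erlf_recurrence_of_exponentially_stable:
  fixes nrm :: "real^'n \<Rightarrow> real"
  assumes nrm: "is_norm nrm" and D: "open D" "locally_lipschitz nrm D f"
    and stable: "exponentially_stable nrm D f xe lam C (nball nrm xe R)"
    and \<tau>: "0 < \<tau>" "C * exp (- (lam - \<alpha>) * \<tau>) < 1" and "0 \<le> \<alpha>"
    and K: "K \<subseteq> nball nrm xe R - {xe}"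
  shows "erlf_recurrence D f (\<lambda>x. nrm (x - xe)) (nball nrm xe R) \<alpha> \<tau> K"
  unfolding erlf_recurrence_def
proof
  fix x assume "x \<in> K"
  then have xS: "x \<in> nball nrm xe R" and "x \<noteq> xe" using K by auto
  then have Vx: "0 < nrm (x - xe)"
    using is_normD(1,2)[OF nrm, of "x - xe"] by simp
  have \<tau>_ex: "\<tau> \<in> existence_interval D f x"
    and decay: "nrm (flow D f \<tau> x - xe) \<le> C * exp (- lam * \<tau>) * nrm (x - xe)"
    using stable xS \<tau>(1) unfolding exponentially_stable_def by auto
  note fl = existence_interval_flow[OF nrm D \<tau>_ex less_imp_le[OF \<tau>(1)]]
  define W where "W s = exp (\<alpha> * s) * nrm (flow D f s x - xe)" for s
  \<comment> \<open>Time 0 is included so that the set is compact; the minimizer is shown afterwards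
    to be positive.\<close>
  define T where "T = {0..\<tau>} \<inter> (\<lambda>s. flow D f s x) -` nball nrm xe R"
  have "W \<tau> \<le> exp (\<alpha> * \<tau>) * (C * exp (- lam * \<tau>) * nrm (x - xe))"
    unfolding W_def by (intro mult_left_mono decay) simp
  also have "\<dots> = C * exp (- (lam - \<alpha>) * \<tau>) * nrm (x - xe)"
    by (simp add: exp_add[symmetric] algebra_simps flip: exp_add)
  also have "\<dots> < nrm (x - xe)"
    using \<tau>(2) Vx by (simp add: mult_less_cancel_right1)
  finally have W\<tau>: "W \<tau> < nrm (x - xe)" .
  \<comment> \<open>Since \<open>\<alpha>\<close> is nonnegative the weight is at least 1, so the
    strict decrease of \<open>W\<close> puts the endpoint back into the ball and \<open>T\<close> is
    nonempty.\<close>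
  have "nrm (flow D f \<tau> x - xe) \<le> W \<tau>"
    using \<tau>(1) \<open>0 \<le> \<alpha>\<close> is_normD(1)[OF nrm, of "flow D f \<tau> x - xe"]
    unfolding W_def by (simp add: mult_le_cancel_right1)
  then have \<tau>T: "\<tau> \<in> T"
    using W\<tau> xS \<tau>(1) by (simp add: T_def nball_def)
  have "closed T"
    unfolding T_def by (intro continuous_closed_preimage fl(2) closed_nball nrm closed_atLeastAtMost)
  then have "compact T"
    using compact_Int_closed[OF compact_Icc, of T 0 \<tau>] by (simp add: T_def Int_absorb1 Int_assoc[symmetric])
  moreover have "continuous_on T W"
    unfolding W_def
    by (intro continuous_intros continuous_on_compose2[OF is_norm_continuous_on[OF nrm, of UNIV]]
        continuous_on_subset[OF fl(2)]) (auto simp: T_def)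
  ultimately obtain s where s: "s \<in> T" "\<And>y. y \<in> T \<Longrightarrow> W s \<le> W y"
    using continuous_attains_inf[of T W] \<tau>T by blast
  have Ws: "W s < nrm (x - xe)" using s(2)[OF \<tau>T] W\<tau> by linarith
  then have "s \<noteq> 0" using fl(3) by (auto simp: W_def)
  then have adm: "s \<in> {0<..\<tau>} \<inter> existence_interval D f x \<and> flow D f s x \<in> nball nrm xe R"
    using s(1) fl(1) by (auto simp: T_def)
  have "\<not> W y < W s"
    if "y \<in> {0<..\<tau>} \<inter> existence_interval D f x \<and> flow D f y x \<in> nball nrm xe R" for y
    using that s(2)[of y] by (auto simp: T_def not_less)
  then show "\<exists>s. is_arg_min (\<lambda>s. exp (\<alpha> * s) * nrm (flow D f s x - xe))
        (\<lambda>s. s \<in> {0<..\<tau>} \<inter> existence_interval D f x \<and> flow D f s x \<in> nball nrm xe R) s \<and>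
      exp (\<alpha> * s) * nrm (flow D f s x - xe) \<le> nrm (x - xe)"
    using adm Ws unfolding W_def is_arg_min_def by (intro exI[of _ s]) auto
qed

text \<open>At the chosen time the center contributes \<open>\<rho> / A\<close> and the factor of
  \<open>r\<close> is \<open>(A - 2) * g\<close>, because \<open>C powr k = A - 2\<close>. With
  \<open>r \<le> r * g \<le> \<rho> / A\<close>, the three terms to be bounded by
  \<open>\<rho>\<close> are at most 1, \<open>A - 2\<close> and 1 shares of
  \<open>\<rho> / A\<close>. This is the origin of the 2 in \<open>2 + C\<beta>\<close>.\<close>

lemma trajectory_check_of_exponentially_stable:
  fixes nrm :: "real^'n \<Rightarrow> real"
  assumes stable: "exponentially_stable nrm D f xe lam C S" and "c \<in> S" and "1 \<le> C"
    and \<alpha>: "\<alpha> < lam" and \<beta>: "\<beta> = (lam - \<alpha>) / (lam + L)" "0 < \<beta>" "\<beta> < 1"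
    and A: "A = 2 + C powr ((1 - \<beta>) / \<beta>)"
    and \<tau>: "ln (C * A) / (lam - \<alpha>) \<le> \<tau>"
    and r: "0 \<le> r" "r \<le> A powr (- 1 / \<beta>) * nrm (c - xe)"
  shows "trajectory_check nrm D f xe \<alpha> L \<tau> c r"
proof -
  define t where "t = ln (C * A) / (lam - \<alpha>)"
  define \<rho> where "\<rho> = nrm (c - xe)"
  \<comment> \<open>The exponent satisfies \<open>1 / \<beta> = 1 + k\<close> and
    \<open>L + \<alpha> = (lam - \<alpha>) * k\<close>; thus \<open>A powr (1 / \<beta>)\<close>
    splits as \<open>A * g\<close>, and the growth factor becomes a power of
    \<open>C * A\<close>.\<close>
  define k where "k = (1 - \<beta>) / \<beta>"
  define g where "g = A powr k"
  have k: "0 < k" "1 / \<beta> = 1 + k"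
    using \<beta>(2,3) by (auto simp: k_def field_simps)
  have Ck: "1 \<le> C powr k" using \<open>1 \<le> C\<close> k(1) by (simp add: ge_one_powr_ge_zero)
  then have A3: "3 \<le> A" using A by (simp add: k_def)
  then have g1: "1 \<le> g" using k(1) by (simp add: g_def ge_one_powr_ge_zero)
  have CA: "1 < C * A"
    using \<open>1 \<le> C\<close> A3 mult_mono[of 1 C 3 A] by linarith
  have t0: "0 < t" using CA \<alpha> by (simp add: t_def)
  have "lam + L \<noteq> 0" using \<beta>(1,2) by auto
  then have Lk: "L + \<alpha> = (lam - \<alpha>) * k"
    using \<beta>(1,2) \<alpha> by (simp add: k_def divide_simps) (simp add: algebra_simps)
  have \<nu>t: "(lam - \<alpha>) * t = ln (C * A)" using \<alpha> by (simp add: t_def)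
  have "exp (\<alpha> * t) * exp (- lam * t) = exp (- ((lam - \<alpha>) * t))"
    by (simp add: algebra_simps flip: exp_add)
  also have "\<dots> = 1 / (C * A)"
    using CA by (simp only: \<nu>t) (simp add: exp_minus inverse_eq_divide)
  finally have e1: "exp (\<alpha> * t) * exp (- lam * t) = 1 / (C * A)" .
  have "exp (\<alpha> * t) * exp (L * t) = exp ((lam - \<alpha>) * t * k)"
    using arg_cong[OF Lk, of "\<lambda>z. z * t"] by (simp add: algebra_simps flip: exp_add)
  also have "\<dots> = (C * A) powr k"
    using \<open>1 \<le> C\<close> A3 by (simp only: \<nu>t) (simp add: powr_def mult.commute)
  also have "\<dots> = (A - 2) * g"
    using \<open>1 \<le> C\<close> A3 by (simp add: powr_mult g_def A k_def)
  finally have e2: "exp (\<alpha> * t) * exp (L * t) = (A - 2) * g" .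
  have ex: "t \<in> existence_interval D f c"
    and decay: "nrm (flow D f t c - xe) \<le> C * exp (- lam * t) * \<rho>"
    using stable \<open>c \<in> S\<close> t0 unfolding exponentially_stable_def \<rho>_def by auto
  have "exp (\<alpha> * t) * (nrm (flow D f t c - xe) + r * exp (L * t))
      \<le> exp (\<alpha> * t) * (C * exp (- lam * t) * \<rho> + r * exp (L * t))"
    by (intro mult_left_mono add_right_mono decay) simp
  also have "\<dots> = C * (exp (\<alpha> * t) * exp (- lam * t)) * \<rho> + r * (exp (\<alpha> * t) * exp (L * t))"
    by (simp only: algebra_simps)
  also have "\<dots> = \<rho> / A + r * ((A - 2) * g)"
    using \<open>1 \<le> C\<close> A3 by (simp only: e1 e2) simp
  also have "\<dots> \<le> \<rho> - r"
  proof -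
    have "A powr (- 1 / \<beta>) = 1 / A powr (1 / \<beta>)"
      by (simp add: powr_minus inverse_eq_divide)
    also have "\<dots> = 1 / (A * g)"
      using A3 by (simp add: k(2) powr_add g_def)
    finally have "r \<le> \<rho> / (A * g)" using r(2) by (simp add: \<rho>_def)
    then have rg: "r * g \<le> \<rho> / A"
      using A3 g1 by (simp add: field_simps)
    have "r * ((A - 2) * g) + r \<le> r * ((A - 2) * g) + r * g"
      using r(1) g1 mult_left_mono[of 1 g r] by simp
    also have "\<dots> = (A - 1) * (r * g)" by (simp add: algebra_simps)
    also have "\<dots> \<le> (A - 1) * (\<rho> / A)"
      using A3 by (intro mult_left_mono rg) simp
    also have "\<dots> = \<rho> - \<rho> / A" using A3 by (simp add: field_simps)
    finally show ?thesis by linarith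
  qed
  finally show ?thesis
    unfolding trajectory_check_def \<rho>_def using ex t0 \<tau> by (intro bexI[of _ t]) (auto simp: t_def)
qed

text \<open>Each shell uses one radius, \<open>q\<close> times its inner radius, which is admissible
  for every center in the shell. Outer and inner radius have ratio \<open>c\<close>, so the packing
  bound is the same for all \<open>m\<close> shells.\<close>

lemma annulus_cover_exists:
  fixes nrm :: "real^'n \<Rightarrow> real" and x :: "real^'n"
  assumes nrm: "is_norm nrm" and "0 < \<epsilon>" "1 \<le> c" "0 < q" "q \<le> 1" "0 < m" "R \<le> \<epsilon> * c ^ m"
  obtains P where "finite P" "real (card P) \<le> real m * (3 * c / q) ^ CARD('n)"
    "\<And>p r. (p, r) \<in> P \<Longrightarrow> p \<in> nball nrm x R \<and> 0 < r \<and> r \<le> q * nrm (p - x)"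
    "{y. \<epsilon> \<le> nrm (y - x) \<and> nrm (y - x) \<le> R} \<subseteq> (\<Union>(p, r)\<in>P. nball nrm p r)"
proof -
  define a where "a j = \<epsilon> * c ^ j" for j
  have a0: "0 < a j" for j using assms by (simp add: a_def)
  \<comment> \<open>The last conjunct keeps centers in the ball of radius \<open>R\<close> even if
    the outermost shell reaches beyond it.\<close>
  define Q where "Q j = {y. a j \<le> nrm (y - x) \<and> nrm (y - x) \<le> a (Suc j) \<and> nrm (y - x) \<le> R}" for j
  have "\<forall>j. \<exists>P. finite P \<and> P \<subseteq> Q j \<and> Q j \<subseteq> (\<Union>p\<in>P. nball nrm p (q * a j)) \<and>
      real (card P) \<le> (3 * c / q) ^ CARD('n)"
  proof
    fix j
    have "Q j \<subseteq> nball nrm x (a (Suc j))" by (auto simp: Q_def nball_def)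
    then obtain P where P: "finite P" "P \<subseteq> Q j" "Q j \<subseteq> (\<Union>p\<in>P. nball nrm p (q * a j))"
      "real (card P) \<le> (1 + 2 * a (Suc j) / (q * a j)) ^ CARD('n)"
      using nball_cover_exists[OF nrm, of "Q j" x "a (Suc j)" "q * a j"] a0[of j] a0[of "Suc j"] \<open>0 < q\<close>
      by (metis less_imp_le mult_pos_pos)
    have "a (Suc j) / a j = c" using assms(2,3) by (simp add: a_def)
    then have "1 + 2 * a (Suc j) / (q * a j) = 1 + 2 * (c / q)"
      by (metis divide_divide_eq_left mult.commute times_divide_eq_right)
    \<comment> \<open>Here \<open>q \<le> 1 \<le> c\<close> gives
      \<open>1 \<le> c / q\<close>.\<close>
    also have "\<dots> \<le> 3 * c / q" using assms by (simp add: field_simps)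
    finally have "(1 + 2 * a (Suc j) / (q * a j)) ^ CARD('n) \<le> (3 * c / q) ^ CARD('n)"
      using a0[of j] a0[of "Suc j"] \<open>0 < q\<close> by (intro power_mono) auto
    with P(4) have "real (card P) \<le> (3 * c / q) ^ CARD('n)" by (rule order_trans)
    with P(1-3) show "\<exists>P. finite P \<and> P \<subseteq> Q j \<and> Q j \<subseteq> (\<Union>p\<in>P. nball nrm p (q * a j)) \<and>
        real (card P) \<le> (3 * c / q) ^ CARD('n)"
      by (intro exI[of _ P] conjI)
  qed
  then obtain F where "\<forall>j. finite (F j) \<and> F j \<subseteq> Q j \<and>
      Q j \<subseteq> (\<Union>p\<in>F j. nball nrm p (q * a j)) \<and> real (card (F j)) \<le> (3 * c / q) ^ CARD('n)"
    by (rule choice[THEN exE])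
  then have F: "finite (F j)" "F j \<subseteq> Q j" "Q j \<subseteq> (\<Union>p\<in>F j. nball nrm p (q * a j))"
    "real (card (F j)) \<le> (3 * c / q) ^ CARD('n)" for j
    by (simp_all only:)
  define P where "P = (\<Union>j<m. (\<lambda>p. (p, q * a j)) ` F j)"
  show ?thesis
  proof
    show "finite P" using F(1) by (simp add: P_def)
    have "card P \<le> (\<Sum>j<m. card ((\<lambda>p. (p, q * a j)) ` F j))"
      unfolding P_def by (rule card_UN_le) simp
    also have "\<dots> \<le> (\<Sum>j<m. card (F j))"
      by (intro sum_mono card_image_le F)
    finally have "real (card P) \<le> (\<Sum>j<m. real (card (F j)))"
      by (metis of_nat_le_iff of_nat_sum)
    also have "\<dots> \<le> (\<Sum>j<m. (3 * c / q) ^ CARD('n))"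
      by (intro sum_mono F)
    finally show "real (card P) \<le> real m * (3 * c / q) ^ CARD('n)" by simp
    show "p \<in> nball nrm x R \<and> 0 < r \<and> r \<le> q * nrm (p - x)" if "(p, r) \<in> P" for p r
    proof -
      obtain j where "p \<in> Q j" "r = q * a j" using \<open>(p, r) \<in> P\<close> F(2) by (auto simp: P_def)
      then show ?thesis using a0[of j] \<open>0 < q\<close> by (auto simp: Q_def nball_def)
    qed
    show "{y. \<epsilon> \<le> nrm (y - x) \<and> nrm (y - x) \<le> R} \<subseteq> (\<Union>(p, r)\<in>P. nball nrm p r)"
    proof
      fix y assume "y \<in> {y. \<epsilon> \<le> nrm (y - x) \<and> nrm (y - x) \<le> R}"
      then have y: "a 0 \<le> nrm (y - x)" "nrm (y - x) \<le> R" by (auto simp: a_def)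
      then have "nrm (y - x) \<le> a m" using assms(7) by (simp add: a_def)
      then obtain k where k: "k \<le> m" "\<And>i. i < k \<Longrightarrow> \<not> nrm (y - x) \<le> a i" "nrm (y - x) \<le> a k"
        using ex_least_nat_le[of "\<lambda>k. nrm (y - x) \<le> a k" m] by blast
      \<comment> \<open>The least \<open>k\<close> with \<open>y\<close> within radius
        \<open>a k\<close> places \<open>y\<close> in shell \<open>k - 1\<close>. The case
        \<open>k = 0\<close> occurs only on the inner boundary, which belongs to shell 0.\<close>
      have "\<exists>j<m. y \<in> Q j"
      proof (cases k)
        case 0
        have "a 0 \<le> a 1" using assms by (simp add: a_def)
        then show ?thesis using 0 k(3) y \<open>0 < m\<close> by (intro exI[of _ 0]) (simp add: Q_def)
      next
        case (Suc j)
        then show ?thesis using k(1,3) k(2)[of j] y by (intro exI[of _ j]) (auto simp: Q_def)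
      qed
      then obtain j p where "j < m" "p \<in> F j" "y \<in> nball nrm p (q * a j)"
        using F(3) by blast
      then show "y \<in> (\<Union>(p, r)\<in>P. nball nrm p r)" by (force simp: P_def)
    qed
  qed
qed

text \<open>As \<open>\<epsilon>\<close> approaches \<open>R\<close> from below,
  \<open>Nev \<epsilon>\<close> tends to 0 while the nonempty annulus still needs one evaluation, so
  the count is claimed only for \<open>\<epsilon>\<close> bounded away from \<open>R\<close>. The
  threshold says exactly that the real number of shells \<open>X\<close> in the proof is at least
  1/3, which lets rounding up cost at most a factor 3.\<close>

theorem theorem9:
  fixes nrm :: "real^'n \<Rightarrow> real"
    and wp :: "real^'n \<Rightarrow> real^'n \<Rightarrow> real"
    and D S :: "(real^'n) set"
    and f :: "real^'n \<Rightarrow> real^'n"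
    and xe :: "real^'n"
    and R lam C \<alpha> \<beta> C\<beta> L \<tau> :: real
    and d :: nat
    and Nev :: "real \<Rightarrow> real"
    and K :: "real \<Rightarrow> (real^'n) set"
  assumes d: "d = CARD('n)"
    and norm: "is_norm nrm"
    and pairing: "associated_weak_pairing nrm wp"
    and D: "open D"
    and f: "locally_lipschitz nrm D f"
    and xe: "xe \<in> D" "f xe = 0"
    and R: "R > 0"
    and S: "S = nball nrm xe R" "S \<subseteq> D"
    and L: "is_one_sided_lipschitz_constant nrm wp f (closure (reachable_tube D f \<tau> S)) L"
    and lam: "lam > 0"
    and C: "C \<ge> 1"
    and stable: "exponentially_stable nrm D f xe lam C S"
    and \<alpha>: "0 < \<alpha>" "\<alpha> < lam"
    and \<beta>: "\<beta> = (lam - \<alpha>) / (lam + L)" "0 < \<beta>" "\<beta> < 1"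
    and C\<beta>: "C\<beta> = C powr ((1 - \<beta>) / \<beta>)"
    and \<tau>: "\<tau> = 1 / (lam - \<alpha>) * ln (C * (2 + C\<beta>) * exp (\<beta> / real d))"
    and K: "\<And>\<epsilon>. K \<epsilon> = closure (S - nball nrm xe \<epsilon>)"
    and Nev: "\<And>\<epsilon>. Nev \<epsilon> =
        ln (R / \<epsilon>) * 3 ^ (d + 1) * (real d * exp 1 / \<beta>) * (2 + C\<beta>) powr (real d / \<beta>)"
  shows "(\<forall>\<epsilon>>0. nball nrm xe \<epsilon> \<subseteq> interior S \<and> \<epsilon> \<le> R * exp (- \<beta> / (3 * real d)) \<longrightarrow>
            erlf_recurrence D f (\<lambda>x. nrm (x - xe)) S \<alpha> \<tau> (K \<epsilon>) \<and>
            (\<exists>n::nat. real n \<le> Nev \<epsilon> \<and>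
               verified_with_evaluations nrm D f xe S \<alpha> L \<tau> (K \<epsilon>) n)) \<and>
         Nev \<in> O[at_right 0](\<lambda>\<epsilon>. ln (R / \<epsilon>))"
proof -
  define A where "A = 2 + C\<beta>"
  have d0: "0 < d" using d by simp
  have "1 \<le> C\<beta>" using C \<beta>(2,3) by (simp add: C\<beta> ge_one_powr_ge_zero)
  then have A3: "3 \<le> A" by (simp add: A_def)
  have CA: "1 < C * A" using C A3 mult_mono[of 1 C 3 A] by linarith
  have \<tau>': "(lam - \<alpha>) * \<tau> = ln (C * A) + \<beta> / real d"
    using CA \<alpha>(2) by (simp add: \<tau> A_def[symmetric] ln_mult_pos)
  have \<beta>d: "0 < \<beta> / real d" using \<beta>(2) d0 by simp
  \<comment> \<open>The factor \<open>exp (\<beta> / real d)\<close> adds a positive amount to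
    \<open>\<tau>\<close>, so the time used for the check lies within the allowed duration.\<close>
  have \<tau>_ge: "ln (C * A) / (lam - \<alpha>) \<le> \<tau>"
    using \<tau>' \<beta>d \<alpha>(2) by (simp add: field_simps)
  moreover have "0 < ln (C * A) / (lam - \<alpha>)" using CA \<alpha>(2) by simp
  ultimately have \<tau>0: "0 < \<tau>" by linarith
  have "exp (- (lam - \<alpha>) * \<tau>) \<le> exp (- ln (C * A))"
    using \<tau>' \<beta>d by (simp only: exp_le_cancel_iff mult_minus_left)
  also have "\<dots> = 1 / (C * A)" using CA by (simp add: exp_minus inverse_eq_divide)
  finally have "C * exp (- (lam - \<alpha>) * \<tau>) \<le> C * (1 / (C * A))"
    using C by (intro mult_left_mono) auto
  also have "\<dots> = 1 / A" using C by simp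
  also have "\<dots> < 1" using A3 by simp
  finally have contr: "C * exp (- (lam - \<alpha>) * \<tau>) < 1" .
  have stable': "exponentially_stable nrm D f xe lam C (nball nrm xe R)"
    using stable S(1) by simp
  \<comment> \<open>Passing to the closed annulus absorbs the closure in \<open>K\<close>, and it
    keeps \<open>xe\<close> out when \<epsilon> is positive.\<close>
  have K_sub: "K \<epsilon> \<subseteq> {y. \<epsilon> \<le> nrm (y - xe) \<and> nrm (y - xe) \<le> R}" for \<epsilon>
    unfolding K
  proof (rule closure_minimal)
    show "S - nball nrm xe \<epsilon> \<subseteq> {y. \<epsilon> \<le> nrm (y - xe) \<and> nrm (y - xe) \<le> R}"
      by (auto simp: S(1) nball_def)
    show "closed {y. \<epsilon> \<le> nrm (y - xe) \<and> nrm (y - xe) \<le> R}"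
      by (intro closed_Collect_conj closed_Collect_le continuous_intros
          continuous_on_compose2[OF is_norm_continuous_on[OF norm, of UNIV]]) auto
  qed
  have rec: "erlf_recurrence D f (\<lambda>x. nrm (x - xe)) S \<alpha> \<tau> (K \<epsilon>)" if "0 < \<epsilon>" for \<epsilon>
    unfolding S(1)
  proof (rule erlf_recurrence_of_exponentially_stable[OF norm D f stable' \<tau>0 contr])
    show "K \<epsilon> \<subseteq> nball nrm xe R - {xe}"
      using K_sub[of \<epsilon>] that is_normD(5)[OF norm] by (auto simp: nball_def)
  qed (use \<alpha>(1) in simp)
  have ver: "\<exists>n::nat. real n \<le> Nev \<epsilon> \<and> verified_with_evaluations nrm D f xe S \<alpha> L \<tau> (K \<epsilon>) n"
    if \<epsilon>: "0 < \<epsilon>" "\<epsilon> \<le> R * exp (- \<beta> / (3 * real d))" for \<epsilon>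
  proof -
    define q where "q = A powr (- 1 / \<beta>)"
    \<comment> \<open>The real number of shells of ratio \<open>exp (\<beta> / real d)\<close>
      leading from \<epsilon> to \<open>R\<close>; \<open>m\<close> rounds it up.\<close>
    define X where "X = ln (R / \<epsilon>) * real d / \<beta>"
    define m where "m = nat \<lceil>X\<rceil>"
    define c where "c = exp (\<beta> / real d)"
    have "exp (\<beta> / (3 * real d)) \<le> R / \<epsilon>"
      using \<epsilon> by (simp add: exp_minus field_simps)
    then have "\<beta> / (3 * real d) \<le> ln (R / \<epsilon>)"
      using R \<epsilon>(1) by (simp add: ln_ge_iff)
    then have X: "1 / 3 \<le> X"
      using \<beta>(2) d0 by (simp add: X_def field_simps)
    then have m0: "0 < m" by (simp add: m_def)
    have X_le: "X \<le> real m" by (simp add: m_def real_nat_ceiling_ge)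
    \<comment> \<open>If \<open>X \<le> 1\<close> a single shell suffices and
      \<open>1 \<le> 3 * X\<close>; otherwise \<open>m < X + 1 < 2 * X\<close>. This factor 3 joins
      the \<open>3 ^ d\<close> of the packing bound to form \<open>3 ^ (d + 1)\<close>.\<close>
    have m_le: "real m \<le> 3 * X"
    proof (cases "X \<le> 1")
      case True
      then have "m \<le> 1" by (simp add: m_def ceiling_le_iff)
      then show ?thesis using X by linarith
    next
      case False
      then show ?thesis by (simp add: m_def) linarith
    qed
    have "R / \<epsilon> = exp (\<beta> / real d * X)"
      using R \<epsilon>(1) \<beta>(2) d0 by (simp add: X_def)
    also have "\<dots> \<le> exp (\<beta> / real d * real m)"
      unfolding exp_le_cancel_iff using \<beta>d by (intro mult_left_mono X_le) simp
    also have "\<dots> = c ^ m"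
      by (simp add: c_def mult.commute flip: exp_of_nat_mult)
    finally have Rm: "R \<le> \<epsilon> * c ^ m" using \<epsilon>(1) by (simp add: field_simps)
    have "A powr (- 1 / \<beta>) \<le> A powr 0"
      using A3 \<beta>(2) by (intro powr_mono) auto
    then have q: "0 < q" "q \<le> 1" using A3 by (auto simp: q_def)
    have c1: "1 \<le> c" using \<beta>d by (simp add: c_def)
    obtain P where P: "finite P" "real (card P) \<le> real m * (3 * c / q) ^ d"
      "\<And>p r. (p, r) \<in> P \<Longrightarrow> p \<in> nball nrm xe R \<and> 0 < r \<and> r \<le> q * nrm (p - xe)"
      "{y. \<epsilon> \<le> nrm (y - xe) \<and> nrm (y - xe) \<le> R} \<subseteq> (\<Union>(p, r)\<in>P. nball nrm p r)"
      by (rule annulus_cover_exists[OF norm \<epsilon>(1) c1 q m0 Rm, of xe, folded d], rule that) blast+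
    \<comment> \<open>The verification notion indexes centers and radii by the numbers below
      \<open>n\<close>, so the finite set of pairs is enumerated.\<close>
    obtain h where h: "bij_betw h {0..<card P} P"
      using ex_bij_betw_nat_finite[OF P(1)] by blast
    have hP: "h ` {..<card P} = P"
      using h by (simp add: bij_betw_def atLeast0LessThan)
    have "verified_with_evaluations nrm D f xe S \<alpha> L \<tau> (K \<epsilon>) (card P)"
      unfolding verified_with_evaluations_def
    proof (intro exI conjI allI impI)
      fix k assume "k < card P"
      then have "(fst (h k), snd (h k)) \<in> P" using hP by auto
      from P(3)[OF this] have hk: "fst (h k) \<in> S" "0 < snd (h k)"
        "snd (h k) \<le> q * nrm (fst (h k) - xe)" using S(1) by auto
      then show "fst (h k) \<in> S" "snd (h k) > 0" by auto
      show "trajectory_check nrm D f xe \<alpha> L \<tau> (fst (h k)) (snd (h k))"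
        using hk unfolding q_def
        by (intro trajectory_check_of_exponentially_stable[OF stable _ C \<alpha>(2) \<beta> _ \<tau>_ge])
          (auto simp: A_def C\<beta>)
    next
      have "(\<Union>(p, r)\<in>P. nball nrm p r) = (\<Union>k<card P. nball nrm (fst (h k)) (snd (h k)))"
        by (subst hP[symmetric]) (simp add: case_prod_beta)
      then show "K \<epsilon> \<subseteq> (\<Union>k<card P. nball nrm (fst (h k)) (snd (h k)))"
        using K_sub[of \<epsilon>] P(4) by simp
    qed
    moreover have "real (card P) \<le> Nev \<epsilon>"
    proof -
      have "1 / q = A powr (1 / \<beta>)"
        by (simp add: q_def powr_minus inverse_eq_divide)
      then have "(1 / q) ^ d = A powr (real d / \<beta>)"
        using A3 by (simp add: powr_realpow[symmetric] powr_powr)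
      moreover have "c ^ d = exp \<beta>"
        using d0 by (simp add: c_def flip: exp_of_nat_mult)
      moreover have "(3 * c / q) ^ d = 3 ^ d * c ^ d * (1 / q) ^ d"
        by (simp add: power_mult_distrib power_divide)
      ultimately have pw: "(3 * c / q) ^ d = 3 ^ d * exp \<beta> * A powr (real d / \<beta>)" by simp
      have "real (card P) \<le> real m * (3 ^ d * exp \<beta> * A powr (real d / \<beta>))"
        using P(2) pw by simp
      \<comment> \<open>The shell ratio raised to the power \<open>d\<close> is
        \<open>exp \<beta>\<close>, at most \<open>exp 1\<close> because \<open>\<beta> < 1\<close>;
        this is the \<open>e\<close> in the count.\<close>
      also have "\<dots> \<le> 3 * X * (3 ^ d * exp 1 * A powr (real d / \<beta>))"
        using m_le X \<beta>(3) by (intro mult_mono) auto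
      also have "\<dots> = Nev \<epsilon>"
        by (simp add: Nev X_def A_def field_simps)
      finally show ?thesis .
    qed
    ultimately show ?thesis by blast
  qed
  have "Nev \<in> O[at_right 0](\<lambda>\<epsilon>. ln (R / \<epsilon>))"
  proof (rule bigoI)
    show "\<forall>\<^sub>F \<epsilon> in at_right 0. norm (Nev \<epsilon>) \<le>
        \<bar>3 ^ (d + 1) * (real d * exp 1 / \<beta>) * (2 + C\<beta>) powr (real d / \<beta>)\<bar> * norm (ln (R / \<epsilon>))"
      by (intro always_eventually allI) (simp add: Nev abs_mult mult_ac)
  qed
  then show ?thesis using rec ver by blast
qed

end
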